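(* If $r \geq 5$ is an integer, then $\mathrm{gcover}(BF(r)) = \lceil (2/3)\, 2^{r}\rceil$.
   Context: A geodesic of a graph $G$ is a shortest path in $G$ between its two end vertices. A geodesic cover of $G$ is a set of geodesics such that each vertex of $G$ belongs to at least one of them; $\mathrm{gcover}(G)$ denotes the minimum cardinality of a geodesic cover of $G$. The $r$-dimensional butterfly network $BF(r)$ is the (undirected) graph with vertices $[j,s]$, where $j\in\{0,1,\ldots,r\}$ and $s=(s_0,\ldots,s_{r-1})\in\{0,1\}^r$; vertices $[j,s]$ and $[j',s']$ are adjacent if $j'=j+1$ and either $s=s'$ or $s$ and $s'$ differ precisely in the $j$-th bit (the coordinate indexed by $j$, for $0\le j\le r-1$). The vertex $[j,s]$ is said to be at level $j$. *)

theory Defs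
  imports Complex_Main "Graph_Theory.Graph_Theory"
begin

text \<open>
  A path is given by its list of vertices, so a path with at least one edge and its reversal are two
  different lists; this does not affect the minimum size of a cover. Paths with a single vertex
  are allowed.
\<close>

definition geodesic :: "('a, 'b) pre_digraph \<Rightarrow> 'a vwalk \<Rightarrow> bool" where
  "geodesic G p \<longleftrightarrow> vpath p G \<and>
     (\<forall>q. vpath q G \<and> hd q = hd p \<and> last q = last p \<longrightarrow> vwalk_length p \<le> vwalk_length q)"

definition geodesic_cover :: "('a, 'b) pre_digraph \<Rightarrow> 'a vwalk set \<Rightarrow> bool" where
  "geodesic_cover G C \<longleftrightarrow> (\<forall>p\<in>C. geodesic G p) \<and> (\<forall>v\<in>verts G. \<exists>p\<in>C. v \<in> set p)"

text \<open>
  Finiteness is required explicitly because \<^term>\<open>card\<close> is 0 on infinite sets. For a finite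
  graph the minimum exists, see \<open>geodesic_cover_exists\<close> below.
\<close>

definition gcover :: "('a, 'b) pre_digraph \<Rightarrow> nat" where
  "gcover G = (LEAST k. \<exists>C. finite C \<and> geodesic_cover G C \<and> card C = k)"

text \<open>
  Undirected graphs are symmetric digraphs, so both orientations of every edge are arcs.
  The string \<open>s = (s\<^sub>0, \<dots>, s\<^bsub>r-1\<^esub>)\<close> is a Boolean list indexed from 0.
\<close>

definition butterfly_verts :: "nat \<Rightarrow> (nat \<times> bool list) set" where
  "butterfly_verts r = {(j, s). j \<le> r \<and> length s = r}"

definition butterfly_up_arcs :: "nat \<Rightarrow> (nat \<times> bool list) rel" where
  "butterfly_up_arcs r = {((j, s), (j', s')) | j s j' s'.
     (j, s) \<in> butterfly_verts r \<and> (j', s') \<in> butterfly_verts r \<and> j' = j + 1 \<and>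
     (s = s' \<or> (\<forall>i<r. s ! i \<noteq> s' ! i \<longleftrightarrow> i = j))}"

definition butterfly :: "nat \<Rightarrow> (nat \<times> bool list) pair_pre_digraph" where
  "butterfly r = \<lparr> pverts = butterfly_verts r,
     parcs = butterfly_up_arcs r \<union> (butterfly_up_arcs r)\<inverse> \<rparr>"

lemma finite_butterfly_verts: "finite (butterfly_verts r)"
proof -
  have "butterfly_verts r = {..r} \<times> {s. set s \<subseteq> UNIV \<and> length s = r}"
    by (auto simp: butterfly_verts_def)
  then show ?thesis
    by (simp only: finite_cartesian_product finite_atMost finite_lists_length_eq finite_UNIV)
qed

lemma butterfly_up_arcs_subset: "butterfly_up_arcs r \<subseteq> butterfly_verts r \<times> butterfly_verts r"
  unfolding butterfly_up_arcs_def by blast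

lemma butterfly_up_arcs_level: "(u, v) \<in> butterfly_up_arcs r \<Longrightarrow> fst v = fst u + 1"
  unfolding butterfly_up_arcs_def
  by (elim CollectE exE conjE Pair_inject) (simp only: fst_conv)

lemma pair_graph_butterfly: "pair_graph (butterfly r)"
proof
  fix e assume e: "e \<in> parcs (butterfly r)"
  then show "fst e \<in> pverts (butterfly r)" "snd e \<in> pverts (butterfly r)"
    using butterfly_up_arcs_subset[of r] by (auto simp: butterfly_def)
  from e show "fst e \<noteq> snd e"
    by (cases e) (auto simp: butterfly_def dest: butterfly_up_arcs_level)
next
  show "finite (pverts (butterfly r))"
    by (simp add: butterfly_def finite_butterfly_verts)
  have "finite (butterfly_up_arcs r)"
    by (rule finite_subset[OF butterfly_up_arcs_subset]) (simp add: finite_butterfly_verts)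
  then show "finite (parcs (butterfly r))"
    by (simp add: butterfly_def)
next
  show "symmetric (with_proj (butterfly r))"
    by (simp add: symmetric_def butterfly_def sym_Un_converse)
qed

lemma geodesic_cover_exists:
  assumes "finite (verts G)"
  shows "\<exists>C. finite C \<and> geodesic_cover G C"
proof (intro exI conjI)
  show "finite ((\<lambda>v. [v]) ` verts G)" using assms by simp
  show "geodesic_cover G ((\<lambda>v. [v]) ` verts G)"
    by (simp add: geodesic_cover_def geodesic_def vpath_def vwalk_def)
qed

end

theory Submission
  imports Defs
begin

text \<open>
  The lower bound counts the vertices on the two extreme levels 0 and \<open>r\<close>. There are
  \<open>2 * 2^r\<close> of them, and a geodesic contains at most three. The reason is that a vertex of
  level 0 and a vertex of level \<open>r\<close> are always at distance exactly \<open>r\<close>, while on each extreme level the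
  distance is an ultrametric (twice the number of levels that have to be crossed to reach the farthest bit
  to be changed). Since distances add up along a geodesic, any three extreme vertices on it
  must alternate between the two levels (\<open>extremes_alternate\<close>), and with four extreme vertices
  some three of them would not.

  For the upper bound, a column is the set of the vertices \<open>[j, s]\<close> with the same string \<open>s\<close>. Geodesics
  with three extreme vertices come in two kinds: down from level 0 to level \<open>r\<close> and up again,
  where the last bits of the two ends differ, and the same upside down, where the first bits differ. If
  \<open>a\<close>, \<open>b\<close>, \<open>c\<close> are strings such that \<open>b\<close> and \<open>c\<close> differ in the first bit only, while \<open>a\<close> and \<open>b\<close> have
  the same first bit and different last bits, then one geodesic of each kind suffices to cover the three columns
  (\<open>covers_columns_tromino\<close>). Write strings as cells of a board with two rows, indexed by the first bit,
  and \<open>2^(r-1)\<close> positions in each row, ordered so that neighbouring positions have different last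
  bits. The above triples then include all L-shaped trominoes \<open>b\<close>, \<open>a\<close>, \<open>c\<close> with corner \<open>b\<close>.
  Trominoes tile the board up to one or two cells, each of which costs one geodesic. As two geodesics
  per tromino is \<open>2/3\<close> per string, and the remainder only accounts for the rounding, this
  meets the lower bound.
\<close>

section \<open>Geodesics and powers of the adjacency relation\<close>

lemma relpow_nth_vwalk:
  assumes "vwalk p G" and "j < length p" and "i \<le> j"
  shows "(p ! i, p ! j) \<in> arcs_ends G ^^ (j - i)"
  using assms
proof (induction p arbitrary: i j)
  case (Base u)
  then show ?case by simp
next
  case (Cons u v p)
  show ?case
  proof (cases i)
    case (Suc i')
    then show ?thesis using Cons.IH[of "j - 1" i'] Cons.prems by (cases j) auto
  next
    case i: 0
    show ?thesis
    proof (cases j)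
      case (Suc j')
      then have "(v, (u # v # p) ! j) \<in> arcs_ends G ^^ j'"
        using Cons.IH[of j' 0] Cons.prems by simp
      then have "(u, (u # v # p) ! j) \<in> arcs_ends G ^^ Suc j'"
        using Cons.hyps(1) by (blast intro: relpow_Suc_I2)
      then show ?thesis using i Suc by simp
    qed (use i in simp)
  qed
qed

lemma (in wf_digraph) vwalk_of_relpow:
  assumes "(u, v) \<in> arcs_ends G ^^ n" and "u \<in> verts G"
  shows "\<exists>q. vwalk q G \<and> hd q = u \<and> last q = v \<and> length q = Suc n"
  using assms
proof (induction n arbitrary: u)
  case 0
  then show ?case by (intro exI[of _ "[u]"]) (auto simp: vwalk_def)
next
  case (Suc n)
  then obtain w where w: "(u, w) \<in> arcs_ends G" "(w, v) \<in> arcs_ends G ^^ n"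
    by (blast elim: relpow_Suc_E2)
  then have "w \<in> verts G" by (auto simp: arcs_ends_def arc_to_ends_def)
  with Suc.IH w(2) obtain q where q: "vwalk q G" "hd q = w" "last q = v" "length q = Suc n"
    by blast
  have "vwalk (u # q) G" using q w Suc.prems(2) by (intro vwalk_consI) auto
  with q show ?case by (intro exI[of _ "u # q"]) (auto simp: vwalk_def)
qed

lemma length_vwalk_to_vpath_le: "length (vwalk_to_vpath p) \<le> length p"
proof (induction p rule: vwalk_to_vpath.induct)
  case (2 x xs)
  then show ?case using length_dropWhile_le[of "\<lambda>y. y \<noteq> x" xs] by auto
qed simp

lemma nth_connected_ends:
  assumes "vwalk p G" and "i < length p" and "j < length p"
    and "(p ! i, p ! j) \<in> arcs_ends G ^^ n"
  shows "(hd p, last p) \<in> arcs_ends G ^^ (i + n + (length p - 1 - j))"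
proof -
  have "p \<noteq> []" using assms(2) by auto
  then have "hd p = p ! 0" and "last p = p ! (length p - 1)"
    by (simp_all add: hd_conv_nth last_conv_nth)
  moreover have "(p ! 0, p ! i) \<in> arcs_ends G ^^ i"
    using relpow_nth_vwalk[of p G i 0] assms by simp
  moreover have "(p ! j, p ! (length p - 1)) \<in> arcs_ends G ^^ (length p - 1 - j)"
    using relpow_nth_vwalk[of p G "length p - 1" j] assms by simp
  ultimately show ?thesis using assms(4) by (auto simp: relpow_add)
qed

text \<open>
  Minimality among paths is the same as minimality among walks, since every walk can be shortened
  to a path. This turns statements about geodesics into statements about powers of the adjacency
  relation, which compose freely and need no lists.
\<close>

lemma (in wf_digraph) geodesic_iff_relpow:
  "geodesic G p \<longleftrightarrow>
     vwalk p G \<and> (\<forall>n. (hd p, last p) \<in> arcs_ends G ^^ n \<longrightarrow> length p \<le> Suc n)"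
proof (intro iffI conjI allI impI)
  assume geo: "geodesic G p"
  then show p: "vwalk p G" by (auto simp: geodesic_def)
  fix n assume "(hd p, last p) \<in> arcs_ends G ^^ n"
  moreover have "hd p \<in> verts G" using p by (cases p) (auto simp: vwalk_def)
  ultimately obtain q where q: "vwalk q G" "hd q = hd p" "last q = last p" "length q = Suc n"
    using vwalk_of_relpow by blast
  let ?q = "vwalk_to_vpath q"
  have "vpath ?q G \<and> hd ?q = hd p \<and> last ?q = last p"
    using q by (simp add: vwalk_to_vpath_vpath vwalk_to_vpath_hd vwalk_to_vpath_last)
  with geo have "vwalk_length p \<le> vwalk_length ?q" unfolding geodesic_def by blast
  then show "length p \<le> Suc n" using length_vwalk_to_vpath_le[of q] q(4) by simp
next
  assume min: "vwalk p G \<and> (\<forall>n. (hd p, last p) \<in> arcs_ends G ^^ n \<longrightarrow> length p \<le> Suc n)"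
  have "distinct p"
    unfolding distinct_conv_nth
  proof (intro allI impI)
    \<comment> \<open>A repeated vertex would allow the part of the walk between its occurrences to be cut out.\<close>
    have less: "p ! i \<noteq> p ! j" if "i < j" "j < length p" for i j
      using nth_connected_ends[of p G i j 0] min that by force
    fix i j assume "i < length p" "j < length p" "i \<noteq> j"
    then show "p ! i \<noteq> p ! j" using less[of i j] less[of j i] by (cases "i < j") auto
  qed
  moreover have "vwalk_length p \<le> vwalk_length q"
    if "vpath q G" "hd q = hd p" "last q = last p" for q
  proof -
    have q: "vwalk q G" "q \<noteq> []" using that by (auto simp: vpath_def)
    then have "(hd q, last q) \<in> arcs_ends G ^^ (length q - 1)"
      using relpow_nth_vwalk[of q G "length q - 1" 0] by (simp add: hd_conv_nth last_conv_nth)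
    with min that have "length p \<le> Suc (length q - 1)" by simp
    then show ?thesis by simp
  qed
  ultimately show "geodesic G p" using min by (auto simp: geodesic_def)
qed

lemma (in wf_digraph) geodesic_nth_dist:
  assumes "geodesic G p" and "i < length p" and "j < length p"
    and "(p ! i, p ! j) \<in> arcs_ends G ^^ n"
  shows "j - i \<le> n"
proof -
  have "vwalk p G" "length p \<le> Suc (i + n + (length p - 1 - j))"
    using assms nth_connected_ends[of p G i j n] geodesic_iff_relpow by blast+
  then show ?thesis using assms by simp
qed

section \<open>Distances in the butterfly network\<close>

abbreviation BF :: "nat \<Rightarrow> (nat \<times> bool list, (nat \<times> bool list) \<times> (nat \<times> bool list)) pre_digraph"
  where "BF r \<equiv> with_proj (butterfly r)"

abbreviation adj :: "nat \<Rightarrow> (nat \<times> bool list) rel" where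
  "adj r \<equiv> parcs (butterfly r)"

lemma wf_digraph_BF: "wf_digraph (BF r)"
proof -
  interpret pair_graph "butterfly r" by (rule pair_graph_butterfly)
  show ?thesis by (rule wf_digraph_axioms)
qed

lemma verts_BF: "pverts (butterfly r) = butterfly_verts r"
  by (simp add: butterfly_def)

lemma geodesic_BF_relpow:
  assumes "geodesic (BF r) p" and "j < length p" and "i \<le> j"
  shows "(p ! i, p ! j) \<in> adj r ^^ (j - i)"
  using relpow_nth_vwalk[of p "BF r" j i] assms by (simp add: geodesic_def vpath_def)

lemma geodesic_BF_dist:
  assumes "geodesic (BF r) p" and "i < length p" and "j < length p"
    and "(p ! i, p ! j) \<in> adj r ^^ n"
  shows "j - i \<le> n"
  using wf_digraph.geodesic_nth_dist[OF wf_digraph_BF assms(1-3)] assms(4) by simp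

lemma adj_sym: "(u, v) \<in> adj r \<longleftrightarrow> (v, u) \<in> adj r"
  by (auto simp: butterfly_def)

lemma relpow_adj_sym: "(u, v) \<in> adj r ^^ n \<Longrightarrow> (v, u) \<in> adj r ^^ n"
proof (induction n arbitrary: v)
  case (Suc n)
  then obtain w where "(u, w) \<in> adj r ^^ n" "(w, v) \<in> adj r" by auto
  with Suc.IH[of w] show ?case by (blast intro: relpow_Suc_I2 adj_sym[THEN iffD1])
qed simp

lemma adj_cases:
  assumes "(u, v) \<in> adj r"
  obtains "fst v = Suc (fst u)" "\<forall>i<r. snd u ! i \<noteq> snd v ! i \<longrightarrow> i = fst u"
  | "fst u = Suc (fst v)" "\<forall>i<r. snd u ! i \<noteq> snd v ! i \<longrightarrow> i = fst v"
  using assms unfolding butterfly_def butterfly_up_arcs_def by (auto; blast)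

lemma relpow_adj_levels:
  assumes "(u, v) \<in> adj r ^^ n"
  shows "fst u \<le> fst v + n" and "fst v \<le> fst u + n"
proof -
  have "fst u \<le> fst v + n \<and> fst v \<le> fst u + n"
    using assms
  proof (induction n arbitrary: v)
    case (Suc n)
    then obtain w where "(u, w) \<in> adj r ^^ n" "(w, v) \<in> adj r" by auto
    with Suc.IH[of w] show ?case by (auto elim: adj_cases)
  qed simp
  then show "fst u \<le> fst v + n" "fst v \<le> fst u + n" by auto
qed

text \<open>
  Bit \<^term>\<open>i\<close> can only change on an edge between levels \<^term>\<open>i\<close> and \<^term>\<open>i + 1\<close>. A walk
  whose ends differ there must therefore visit both levels, and the length of the two parts before
  and after such a visit is at least the difference of levels.
\<close>

lemma relpow_adj_flip:
  assumes "(u, v) \<in> adj r ^^ n" and "i < r" and "snd u ! i \<noteq> snd v ! i"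
  shows "2 * Suc i \<le> n + fst u + fst v" and "fst u + fst v \<le> n + 2 * i"
proof -
  have "2 * Suc i \<le> n + fst u + fst v \<and> fst u + fst v \<le> n + 2 * i"
    using assms
  proof (induction n arbitrary: v)
    case (Suc n)
    then obtain w where w: "(u, w) \<in> adj r ^^ n" "(w, v) \<in> adj r" by auto
    show ?case
    proof (cases "snd u ! i = snd w ! i")
      case False
      then show ?thesis using Suc.IH[OF w(1) \<open>i < r\<close>] w(2) by (auto elim!: adj_cases)
    next
      case True
      then have "snd w ! i \<noteq> snd v ! i" using Suc.prems by simp
      then have "fst w = i \<and> fst v = Suc i \<or> fst w = Suc i \<and> fst v = i"
        using w(2) \<open>i < r\<close> by (auto elim!: adj_cases)
      then show ?thesis using relpow_adj_levels[OF w(1)] by auto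
    qed
  qed simp
  then show "2 * Suc i \<le> n + fst u + fst v" "fst u + fst v \<le> n + 2 * i" by auto
qed

text \<open>
  The monotone walk from \<open>[0, s]\<close> to \<open>[r, t]\<close>, which replaces the bits of \<^term>\<open>s\<close> by those of
  \<^term>\<open>t\<close> one after the other.
\<close>

definition descent :: "nat \<Rightarrow> bool list \<Rightarrow> bool list \<Rightarrow> (nat \<times> bool list) list" where
  "descent r s t = map (\<lambda>j. (j, take j t @ drop j s)) [0..<Suc r]"

lemma length_descent [simp]: "length (descent r s t) = Suc r"
  by (simp add: descent_def)

lemma nth_descent: "j \<le> r \<Longrightarrow> descent r s t ! j = (j, take j t @ drop j s)"
  by (simp add: descent_def del: upt_Suc)

lemma descent_neq_Nil [simp]: "descent r s t \<noteq> []"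
  by (simp add: descent_def)

lemma hd_descent [simp]: "hd (descent r s t) = (0, s)"
  by (simp add: hd_conv_nth nth_descent)

lemma last_descent [simp]: "length s = r \<Longrightarrow> length t = r \<Longrightarrow> last (descent r s t) = (r, t)"
  by (simp add: last_conv_nth nth_descent)

lemma mem_descent: "j \<le> r \<Longrightarrow> (j, take j t @ drop j s) \<in> set (descent r s t)"
  by (force simp: descent_def simp del: upt_Suc)

lemma mem_descent_self: "j \<le> r \<Longrightarrow> (j, s) \<in> set (descent r s s)"
  using mem_descent[of j r s s] by simp

lemma vwalk_nthI:
  assumes "p \<noteq> []" and "set p \<subseteq> verts G"
    and "\<And>i. Suc i < length p \<Longrightarrow> (p ! i, p ! Suc i) \<in> arcs_ends G"
  shows "vwalk p G"
  using assms
proof (induction p)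
  case (Cons u p)
  show ?case
  proof (cases "p = []")
    case False
    have "vwalk p G" using Cons.IH Cons.prems(2) Cons.prems(3)[of "Suc _"] False by simp
    moreover have "(u, hd p) \<in> arcs_ends G"
      using Cons.prems(3)[of 0] False by (simp add: hd_conv_nth)
    ultimately show ?thesis using Cons.prems(2) by (intro vwalk_consI) auto
  qed (use Cons.prems in \<open>auto simp: vwalk_def\<close>)
qed simp

lemma vwalk_descent:
  assumes "length s = r" and "length t = r"
  shows "vwalk (descent r s t) (BF r)"
proof (rule vwalk_nthI)
  show "set (descent r s t) \<subseteq> verts (BF r)"
    using assms by (auto simp: descent_def verts_BF butterfly_verts_def)
  fix j assume j: "Suc j < length (descent r s t)"
  let ?u = "take j t @ drop j s" and ?v = "take (Suc j) t @ drop (Suc j) s"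
  have agree: "?u ! i = ?v ! i" if "i < r" "i \<noteq> j" for i
    using assms that j by (auto simp: nth_append)
  have "?u = ?v \<or> (\<forall>i<r. ?u ! i \<noteq> ?v ! i \<longleftrightarrow> i = j)"
  proof (cases "?u ! j = ?v ! j")
    case True
    then have "?u ! i = ?v ! i" if "i < r" for i using agree that by (cases "i = j") auto
    then have "?u = ?v" using assms j by (intro nth_equalityI) auto
    then show ?thesis ..
  qed (use agree in blast)
  then have "((j, ?u), (Suc j, ?v)) \<in> butterfly_up_arcs r"
    using assms j by (simp add: butterfly_up_arcs_def butterfly_verts_def)
  then show "(descent r s t ! j, descent r s t ! Suc j) \<in> arcs_ends (BF r)"
    using j by (simp add: nth_descent butterfly_def)
qed simp

lemma dist_between_extremes:
  assumes "length s = r" and "length t = r"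
  shows "((0, s), (r, t)) \<in> adj r ^^ r"
  using relpow_nth_vwalk[OF vwalk_descent[OF assms], of r 0] assms by (simp add: nth_descent)

lemma dist_within_top:
  assumes "length s = r" and "length t = r" and "m \<le> r" and "drop m s = drop m t"
  shows "((0, s), (0, t)) \<in> adj r ^^ (2 * m)"
proof -
  have "((0, s), (m, t)) \<in> adj r ^^ m"
    using relpow_nth_vwalk[OF vwalk_descent[OF assms(1,2)], of m 0] assms by (simp add: nth_descent)
  moreover have "((0, t), (m, t)) \<in> adj r ^^ m"
    using relpow_nth_vwalk[OF vwalk_descent[of t r t], of m 0] assms by (simp add: nth_descent)
  ultimately show ?thesis
    unfolding mult_2 by (metis relpow_trans relpow_adj_sym)
qed

lemma dist_within_bottom:
  assumes "length s = r" and "length t = r" and "m \<le> r" and "take m s = take m t"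
  shows "((r, s), (r, t)) \<in> adj r ^^ (2 * (r - m))"
proof -
  have "((m, s), (r, t)) \<in> adj r ^^ (r - m)"
    using relpow_nth_vwalk[OF vwalk_descent[OF assms(1,2)], of r m] assms(1-3)
    by (simp add: nth_descent flip: assms(4))
  moreover have "((m, s), (r, s)) \<in> adj r ^^ (r - m)"
    using relpow_nth_vwalk[OF vwalk_descent[of s r s], of r m] assms(1,3) by (simp add: nth_descent)
  ultimately show ?thesis
    unfolding mult_2 by (metis relpow_trans relpow_adj_sym)
qed

section \<open>A geodesic has at most three vertices on the extreme levels\<close>

text \<open>
  On level 0 the distance is twice one more than the last differing bit, hence an ultrametric. So no
  vertex of level 0 lies on a geodesic strictly between two others: the three distances could not
  add up. Level \<^term>\<open>r\<close> is the mirror image, with the first differing bit.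
\<close>

lemma no_three_top:
  assumes geo: "geodesic (BF r) p" and ord: "a < b" "b < c" "c < length p"
    and lev: "p ! a = (0, x)" "p ! b = (0, y)" "p ! c = (0, z)"
    and len: "length x = r" "length z = r"
  shows False
proof -
  note dist = geodesic_BF_dist[OF geo] and walk = geodesic_BF_relpow[OF geo]
  define D where "D = {i. i < r \<and> x ! i \<noteq> z ! i}"
  have "D \<noteq> {}"
  proof
    assume "D = {}"
    then have "x = z" using len by (intro nth_equalityI) (auto simp: D_def)
    then show False using dist[of a c 0] ord lev by simp
  qed
  then have "Max D \<in> D" by (intro Max_in) (simp_all add: D_def)
  moreover define m where "m = Max D"
  ultimately have m: "m < r" "x ! m \<noteq> z ! m" by (simp_all add: D_def)
  have "x ! i = z ! i" if "m < i" "i < r" for i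
  proof (rule ccontr)
    assume "x ! i \<noteq> z ! i"
    then have "i \<le> m" unfolding m_def using that by (intro Max_ge) (simp_all add: D_def)
    then show False using that by simp
  qed
  then have "drop (Suc m) x = drop (Suc m) z"
    using len by (intro nth_equalityI) auto
  then have "((0, x), (0, z)) \<in> adj r ^^ (2 * Suc m)"
    using len m by (intro dist_within_top) auto
  then have upper: "c - a \<le> 2 * Suc m" using dist[of a c] lev ord by simp
  have "((0, x), (0, y)) \<in> adj r ^^ (b - a)" "((0, y), (0, z)) \<in> adj r ^^ (c - b)"
    using walk[of b a] walk[of c b] lev ord by simp_all
  note flip = this[THEN relpow_adj_flip(1), OF m(1)]
  from m(2) have "x ! m \<noteq> y ! m \<or> y ! m \<noteq> z ! m" by auto
  then have "2 * Suc m \<le> b - a \<or> 2 * Suc m \<le> c - b" using flip by auto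
  with upper ord show False by linarith
qed

lemma no_three_bottom:
  assumes geo: "geodesic (BF r) p" and ord: "a < b" "b < c" "c < length p"
    and lev: "p ! a = (r, x)" "p ! b = (r, y)" "p ! c = (r, z)"
    and len: "length x = r" "length z = r"
  shows False
proof -
  note dist = geodesic_BF_dist[OF geo] and walk = geodesic_BF_relpow[OF geo]
  define D where "D = {i. i < r \<and> x ! i \<noteq> z ! i}"
  have "D \<noteq> {}"
  proof
    assume "D = {}"
    then have "x = z" using len by (intro nth_equalityI) (auto simp: D_def)
    then show False using dist[of a c 0] ord lev by simp
  qed
  then have "Min D \<in> D" by (intro Min_in) (simp_all add: D_def)
  moreover define m where "m = Min D"
  ultimately have m: "m < r" "x ! m \<noteq> z ! m" by (simp_all add: D_def)
  have "x ! i = z ! i" if "i < m" for i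
  proof (rule ccontr)
    assume "x ! i \<noteq> z ! i"
    then have "m \<le> i" unfolding m_def using that m(1) by (intro Min_le) (simp_all add: D_def)
    then show False using that by simp
  qed
  then have "take m x = take m z"
    using len m(1) by (intro nth_equalityI) auto
  then have "((r, x), (r, z)) \<in> adj r ^^ (2 * (r - m))"
    using len m by (intro dist_within_bottom) auto
  then have upper: "c - a \<le> 2 * (r - m)" using dist[of a c] lev ord by simp
  have "((r, x), (r, y)) \<in> adj r ^^ (b - a)" "((r, y), (r, z)) \<in> adj r ^^ (c - b)"
    using walk[of b a] walk[of c b] lev ord by simp_all
  note flip = this[THEN relpow_adj_flip(2), OF m(1)]
  from m(2) have "x ! m \<noteq> y ! m \<or> y ! m \<noteq> z ! m" by auto
  then have "2 * (r - m) \<le> b - a \<or> 2 * (r - m) \<le> c - b" using flip by auto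
  with upper ord show False by linarith
qed

text \<open>
  Three vertices on one level are excluded already. If two consecutive ones were on the same level and
  the remaining one on the other level, then the latter would be at distance \<^term>\<open>r\<close> from both,
  although one of them lies between it and the other.
\<close>

lemma extremes_alternate:
  assumes geo: "geodesic (BF r) p" and ord: "a < b" "b < c" "c < length p"
    and ext: "fst (p ! a) \<in> {0, r}" "fst (p ! b) \<in> {0, r}" "fst (p ! c) \<in> {0, r}"
  shows "fst (p ! a) \<noteq> fst (p ! b)" and "fst (p ! b) \<noteq> fst (p ! c)"
proof -
  note dist = geodesic_BF_dist[OF geo] and walk = geodesic_BF_relpow[OF geo]
  have vw: "vwalk p (BF r)" using geo by (simp add: geodesic_def vpath_def)
  have vert: "length (snd (p ! i)) = r" if "i < length p" for i
    using vw nth_mem[OF that] by (force simp: vwalk_def verts_BF butterfly_verts_def)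
  have same: "\<not> (fst (p ! a) = fst (p ! b) \<and> fst (p ! b) = fst (p ! c))"
  proof
    assume eq: "fst (p ! a) = fst (p ! b) \<and> fst (p ! b) = fst (p ! c)"
    show False
    proof (cases "fst (p ! a) = 0")
      case True
      then show False
        using eq ord vert
        by (intro no_three_top[OF geo ord, of "snd (p ! a)" "snd (p ! b)" "snd (p ! c)"])
          (auto simp: prod_eq_iff)
    next
      case False
      then show False
        using eq ord vert ext
        by (intro no_three_bottom[OF geo ord, of "snd (p ! a)" "snd (p ! b)" "snd (p ! c)"])
          (auto simp: prod_eq_iff)
    qed
  qed
  have across: "j - i = r"
    if ij: "i < j" "j < length p" "fst (p ! i) \<noteq> fst (p ! j)" "fst (p ! i) \<in> {0, r}" "fst (p ! j) \<in> {0, r}"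
    for i j
  proof (rule antisym)
    have len: "length (snd (p ! i)) = r" "length (snd (p ! j)) = r" using vert ij by auto
    consider "p ! i = (0, snd (p ! i))" "p ! j = (r, snd (p ! j))"
      | "p ! j = (0, snd (p ! j))" "p ! i = (r, snd (p ! i))"
      using ij by (auto simp: prod_eq_iff)
    then have "(p ! i, p ! j) \<in> adj r ^^ r"
    proof cases
      case 1
      show ?thesis using dist_between_extremes[OF len] by (simp flip: 1)
    next
      case 2
      show ?thesis
        using relpow_adj_sym[OF dist_between_extremes[OF len(2,1)]] by (simp flip: 2)
    qed
    then show "j - i \<le> r" using dist ij by simp
    show "r \<le> j - i" using relpow_adj_levels[OF walk[of j i]] ij by auto
  qed
  show "fst (p ! a) \<noteq> fst (p ! b)"
  proof
    assume eq: "fst (p ! a) = fst (p ! b)"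
    then have "fst (p ! b) \<noteq> fst (p ! c)" using same by simp
    then have "c - a = r" "c - b = r" using across[of a c] across[of b c] eq ord ext by simp_all
    then show False using ord by simp
  qed
  show "fst (p ! b) \<noteq> fst (p ! c)"
  proof
    assume eq: "fst (p ! b) = fst (p ! c)"
    then have "fst (p ! a) \<noteq> fst (p ! b)" using same by simp
    then have "c - a = r" "b - a = r" using across[of a c] across[of a b] eq ord ext by simp_all
    then show False using ord by simp
  qed
qed

lemma card_extremes_le_3:
  assumes geo: "geodesic (BF r) p"
  shows "card {v \<in> set p. fst v \<in> {0, r}} \<le> 3"
proof -
  define K where "K = {i. i < length p \<and> fst (p ! i) \<in> {0, r}}"
  have [simp]: "finite K" by (simp add: K_def)
  have "card K \<le> 3"
  proof (rule ccontr)
    assume "\<not> card K \<le> 3"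
    define l where "l = sorted_list_of_set K"
    have len: "3 < length l" using \<open>\<not> card K \<le> 3\<close> by (simp add: l_def)
    have less: "l ! i < l ! j" if "i < j" "j \<le> 3" for i j
      using sorted_wrt_nth_less[OF strict_sorted_list_of_set[of K], of i j] that len
      by (simp add: l_def)
    have mem: "l ! i < length p" "fst (p ! (l ! i)) \<in> {0, r}" if "i \<le> 3" for i
      using nth_mem[of i l] that len by (auto simp: l_def K_def)
    have alt: "fst (p ! (l ! i)) \<noteq> fst (p ! (l ! j))" "fst (p ! (l ! j)) \<noteq> fst (p ! (l ! k))"
      if "i < j" "j < k" "k \<le> 3" for i j k
      using extremes_alternate[OF geo less[of i j] less[of j k]] mem[of i] mem[of j] mem[of k] that
      by simp_all
    \<comment> \<open>The second, third and fourth of these vertices would be on three different levels.\<close>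
    show False
      using alt(2)[of 0 1 2] alt(2)[of 1 2 3] alt(2)[of 0 1 3] mem(2)[of 1] mem(2)[of 2] mem(2)[of 3]
      by auto
  qed
  moreover have "{v \<in> set p. fst v \<in> {0, r}} = (!) p ` K"
    by (force simp: K_def in_set_conv_nth image_iff)
  ultimately show ?thesis using card_image_le[of K "(!) p"] by simp
qed

lemma card_geodesic_cover_ge:
  assumes "finite C" and "geodesic_cover (BF r) C" and "r \<ge> 1"
  shows "2 * 2 ^ r \<le> 3 * card C"
proof -
  let ?E = "\<lambda>p :: (nat \<times> bool list) list. {v \<in> set p. fst v \<in> {0, r}}"
  let ?X = "{0, r} \<times> {s :: bool list. set s \<subseteq> UNIV \<and> length s = r}"
  have "card ?X = 2 * 2 ^ r"
    using assms(3) card_lists_length_eq[of "UNIV :: bool set" r] by (simp add: card_cartesian_product)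
  moreover have "?X \<subseteq> (\<Union>p\<in>C. ?E p)"
    using assms(2) by (fastforce simp: geodesic_cover_def verts_BF butterfly_verts_def)
  then have "card ?X \<le> card (\<Union>p\<in>C. ?E p)"
    using assms(1) by (intro card_mono) auto
  moreover have "card (\<Union>p\<in>C. ?E p) \<le> (\<Sum>p\<in>C. card (?E p))"
    by (rule card_UN_le[OF assms(1)])
  moreover have "(\<Sum>p\<in>C. card (?E p)) \<le> of_nat (card C) * 3"
    using assms(2) by (intro sum_bounded_above card_extremes_le_3) (simp add: geodesic_cover_def)
  ultimately show ?thesis by simp
qed

section \<open>Covering three columns by two geodesics\<close>

text \<open>
  Allowing fewer than \<^term>\<open>n\<close> geodesics makes the bounds add up under unions even when the two
  covers share a geodesic.
\<close>

definition covers_columns :: "nat \<Rightarrow> bool list set \<Rightarrow> nat \<Rightarrow> bool" where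
  "covers_columns r W n \<longleftrightarrow> (\<exists>C. finite C \<and> card C \<le> n \<and> (\<forall>p\<in>C. geodesic (BF r) p) \<and>
     (\<forall>s\<in>W. \<forall>j\<le>r. \<exists>p\<in>C. (j, s) \<in> set p))"

lemma covers_columns_Un:
  assumes "covers_columns r V m" and "covers_columns r W n"
  shows "covers_columns r (V \<union> W) (m + n)"
proof -
  obtain C D where "finite C" "card C \<le> m" "\<forall>p\<in>C. geodesic (BF r) p"
      "\<forall>s\<in>V. \<forall>j\<le>r. \<exists>p\<in>C. (j, s) \<in> set p"
    and "finite D" "card D \<le> n" "\<forall>p\<in>D. geodesic (BF r) p"
      "\<forall>s\<in>W. \<forall>j\<le>r. \<exists>p\<in>D. (j, s) \<in> set p"
    using assms unfolding covers_columns_def by metis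
  then show ?thesis
    unfolding covers_columns_def using card_Un_le[of C D]
    by (intro exI[of _ "C \<union> D"]) (auto; blast)
qed

lemma geodesic_descent:
  assumes "length s = r" and "length t = r"
  shows "geodesic (BF r) (descent r s t)"
proof -
  have "r \<le> n" if "((0, s), (r, t)) \<in> adj r ^^ n" for n
    using relpow_adj_levels(2)[OF that] by simp
  then show ?thesis
    using assms vwalk_descent[OF assms]
    by (simp add: wf_digraph.geodesic_iff_relpow[OF wf_digraph_BF])
qed

lemma covers_columns_single:
  assumes "length s = r"
  shows "covers_columns r {s} 1"
  unfolding covers_columns_def
  using geodesic_descent[OF assms assms] mem_descent_self[of _ r s]
  by (intro exI[of _ "{descent r s s}"]) auto

lemma set_vwalk_join:
  assumes "joinable p q"
  shows "set (vwalk_join p q) = set p \<union> set q"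
proof -
  have "set q = insert (last p) (set (tl q))" using assms by (cases q) (auto simp: joinable_def)
  moreover have "last p \<in> set p" using assms last_in_set[of p] by (simp add: joinable_def)
  ultimately show ?thesis by (auto simp: vwalk_join_def)
qed

lemma vwalk_rev_BF: "vwalk p (BF r) \<Longrightarrow> vwalk (rev p) (BF r)"
  by (auto simp: vwalk_def set_vwalk_arcs_rev intro: adj_sym[THEN iffD1])

lemma geodesic_down_up:
  assumes "length s = r" "length t = r" "length u = r" and "r \<ge> 1" and "s ! (r - 1) \<noteq> u ! (r - 1)"
  shows "\<exists>p. geodesic (BF r) p \<and> set (descent r s t) \<union> set (descent r u t) \<subseteq> set p"
proof -
  let ?p = "vwalk_join (descent r s t) (rev (descent r u t))"
  have j: "joinable (descent r s t) (rev (descent r u t))"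
    using assms by (simp add: hd_rev)
  have "vwalk ?p (BF r)"
    using assms j by (intro vwalk_joinI_vwalk vwalk_rev_BF vwalk_descent)
  moreover have "hd ?p = (0, s)" "last ?p = (0, u)"
    using j by (simp_all add: vwalk_join_hd vwalk_join_last last_rev)
  moreover have "length ?p = Suc (2 * r)" by (simp add: vwalk_join_def)
  moreover have "2 * r \<le> n" if "((0, s), (0, u)) \<in> adj r ^^ n" for n
    using relpow_adj_flip(1)[OF that, of "r - 1"] assms by simp
  ultimately have "geodesic (BF r) ?p"
    by (simp add: wf_digraph.geodesic_iff_relpow[OF wf_digraph_BF])
  then show ?thesis using set_vwalk_join[OF j] by (intro exI[of _ ?p]) simp
qed

lemma geodesic_up_down:
  assumes "length s = r" "length t = r" "length u = r" and "r \<ge> 1" and "t ! 0 \<noteq> u ! 0"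
  shows "\<exists>p. geodesic (BF r) p \<and> set (descent r s t) \<union> set (descent r s u) \<subseteq> set p"
proof -
  let ?p = "vwalk_join (rev (descent r s t)) (descent r s u)"
  have j: "joinable (rev (descent r s t)) (descent r s u)"
    using assms by (simp add: last_rev)
  have "vwalk ?p (BF r)"
    using assms j by (intro vwalk_joinI_vwalk vwalk_rev_BF vwalk_descent)
  moreover have "hd ?p = (r, t)" "last ?p = (r, u)"
    using j assms by (simp_all add: vwalk_join_hd vwalk_join_last hd_rev)
  moreover have "length ?p = Suc (2 * r)" by (simp add: vwalk_join_def)
  moreover have "2 * r \<le> n" if "((r, t), (r, u)) \<in> adj r ^^ n" for n
    using relpow_adj_flip(2)[OF that, of 0] assms by simp
  ultimately have "geodesic (BF r) ?p"
    by (simp add: wf_digraph.geodesic_iff_relpow[OF wf_digraph_BF])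
  then show ?thesis using set_vwalk_join[OF j] by (intro exI[of _ ?p]) simp
qed

text \<open>
  Let \<open>b = e # w\<close> be the corner, \<open>a = e # w'\<close> and \<open>c = (\<not> e) # w\<close>. One geodesic runs down the
  whole column \<open>a\<close> and then up to \<open>[0, b]\<close>; the other runs up the column \<open>b\<close> as far as
  level 1, changes bit 0 on the way to \<open>[0, c]\<close>, and runs down the whole column \<open>c\<close>. The
  last bits of \<open>a\<close> and \<open>b\<close> and the first bits of \<open>b\<close> and \<open>c\<close> differ, which forces the ends of each walk
  to be at distance \<^term>\<open>2 * r\<close>.
\<close>

lemma covers_columns_tromino:
  assumes r: "r = Suc (length w)" and "length w' = length w" and "w \<noteq> []" and "last w \<noteq> last w'"
  shows "covers_columns r {e # w, e # w', (\<not> e) # w} 2"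
proof -
  have [simp]: "w' \<noteq> []" using assms by auto
  obtain p where p: "geodesic (BF r) p"
      "set (descent r (e # w') (e # w')) \<union> set (descent r (e # w) (e # w')) \<subseteq> set p"
    using geodesic_down_up[of "e # w'" r "e # w'" "e # w"] assms by (auto simp: last_conv_nth)
  obtain q where q: "geodesic (BF r) q"
      "set (descent r ((\<not> e) # w) (e # w)) \<union> set (descent r ((\<not> e) # w) ((\<not> e) # w)) \<subseteq> set q"
    using geodesic_up_down[of "(\<not> e) # w" r "e # w" "(\<not> e) # w"] assms by auto
  have "(j, e # w') \<in> set p" and "(j, (\<not> e) # w) \<in> set q" if "j \<le> r" for j
    using p(2) q(2) mem_descent_self[OF that] by blast+
  moreover have "(0, e # w) \<in> set p"
    using p(2) mem_descent[of 0 r "e # w'" "e # w"] by auto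
  moreover have "(j, e # w) \<in> set q" if "j \<le> r" "0 < j" for j
    using q(2) mem_descent[OF that(1), of "e # w" "(\<not> e) # w"] that(2) by (cases j) auto
  ultimately have "\<forall>s\<in>{e # w, e # w', (\<not> e) # w}. \<forall>j\<le>r. \<exists>x\<in>{p, q}. (j, s) \<in> set x"
    by blast
  then show ?thesis
    unfolding covers_columns_def using p(1) q(1)
    by (intro exI[of _ "{p, q}"]) (auto simp: card_insert_if)
qed

section \<open>Tiling a strip of width two by trominoes\<close>

text \<open>
  The most significant bit comes first, so that the last bits of consecutive numbers differ.
\<close>

fun binary :: "nat \<Rightarrow> nat \<Rightarrow> bool list" where
  "binary 0 n = []"
| "binary (Suc l) n = binary l (n div 2) @ [odd n]"

lemma length_binary [simp]: "length (binary l n) = l"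
  by (induction l arbitrary: n) auto

lemma binary_surj: "length w = l \<Longrightarrow> \<exists>n<2 ^ l. binary l n = w"
proof (induction l arbitrary: w)
  case (Suc l)
  then obtain v b where w: "w = v @ [b]" "length v = l" by (cases w rule: rev_cases) auto
  then obtain n where "n < 2 ^ l" "binary l n = v" using Suc.IH by blast
  then show ?case using w by (intro exI[of _ "2 * n + of_bool b"]) auto
qed simp

definition strip :: "nat \<Rightarrow> nat \<Rightarrow> bool list set" where
  "strip l n = {e # binary l i | e i. i < n}"

lemma strip_0: "strip l 0 = {}"
  by (simp add: strip_def)

lemma strip_Suc: "strip l (Suc n) = strip l n \<union> {True # binary l n, False # binary l n}"
  by (auto simp: strip_def less_Suc_eq)

lemma covers_columns_binary:
  assumes "l \<ge> 1" and "odd m \<noteq> odd n"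
  shows "covers_columns (Suc l) {e # binary l m, e # binary l n, (\<not> e) # binary l m} 2"
  using assms by (intro covers_columns_tromino) (cases l; auto)+

text \<open>
  Three more positions of the strip form a 2 by 3 block, which is cut into two trominoes with their
  corners at opposite ends of the block.
\<close>

lemma covers_columns_strip_step:
  assumes "l \<ge> 1" and "covers_columns (Suc l) (strip l n) k"
  shows "covers_columns (Suc l) (strip l (3 + n)) (k + 2 + 2)"
proof -
  have "covers_columns (Suc l) (strip l n \<union>
      {False # binary l n, False # binary l (Suc n), (\<not> False) # binary l n} \<union>
      {True # binary l (Suc (Suc n)), True # binary l (Suc n), (\<not> True) # binary l (Suc (Suc n))})
      (k + 2 + 2)"
    using assms by (intro covers_columns_Un covers_columns_binary) auto
  moreover have "strip l (3 + n) = strip l n \<union>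
      {False # binary l n, False # binary l (Suc n), (\<not> False) # binary l n} \<union>
      {True # binary l (Suc (Suc n)), True # binary l (Suc n), (\<not> True) # binary l (Suc (Suc n))}"
    by (auto simp: numeral_3_eq_3 strip_Suc)
  ultimately show ?thesis by simp
qed

lemma covers_columns_strip:
  assumes "l \<ge> 1"
  shows "covers_columns (Suc l) (strip l n) ((4 * n + 2) div 3)"
proof (induction n rule: less_induct)
  case (less n)
  have single: "covers_columns (Suc l) {e # binary l i} 1" for e i
    by (rule covers_columns_single) simp
  consider "n = 0" | "n = 1" | "n = 2" | "3 \<le> n" by linarith
  then show ?case
  proof cases
    case 1
    have "covers_columns (Suc l) {} 0" by (auto simp: covers_columns_def)
    then show ?thesis using 1 by (simp add: strip_0)
  next
    case 2
    have "covers_columns (Suc l) ({True # binary l 0} \<union> {False # binary l 0}) (1 + 1)"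
      by (intro covers_columns_Un single)
    moreover have "strip l 1 = {True # binary l 0} \<union> {False # binary l 0}"
      using strip_Suc[of l 0] by (auto simp: strip_0)
    ultimately show ?thesis using 2 by (simp add: numeral_2_eq_2)
  next
    case 3
    have "covers_columns (Suc l)
        ({False # binary l 0, False # binary l 1, (\<not> False) # binary l 0} \<union> {True # binary l 1}) (2 + 1)"
      using assms by (intro covers_columns_Un covers_columns_binary single) auto
    moreover have "strip l 2 =
        {False # binary l 0, False # binary l 1, (\<not> False) # binary l 0} \<union> {True # binary l 1}"
      by (auto simp: numeral_2_eq_2 strip_0 strip_Suc)
    ultimately show ?thesis using 3 by simp
  next
    case 4
    then obtain m where m: "n = 3 + m" by (rule less_eqE)
    then have "covers_columns (Suc l) (strip l (3 + m)) ((4 * m + 2) div 3 + 2 + 2)"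
      using assms by (intro covers_columns_strip_step less.IH) auto
    moreover have "(4 * m + 2) div 3 + 2 + 2 = (4 * n + 2) div 3" using m by simp
    ultimately show ?thesis using m by simp
  qed
qed

section \<open>The geodesic cover number\<close>

lemma geodesic_cover_upper:
  assumes "r \<ge> 2"
  shows "\<exists>C. finite C \<and> geodesic_cover (BF r) C \<and> card C \<le> (2 * 2 ^ r + 2) div 3"
proof -
  obtain l where l: "r = Suc l" "l \<ge> 1" using assms by (cases r) auto
  obtain C where C: "finite C" "card C \<le> (4 * 2 ^ l + 2) div 3" "\<forall>p\<in>C. geodesic (BF r) p"
      "\<forall>s\<in>strip l (2 ^ l). \<forall>j\<le>r. \<exists>p\<in>C. (j, s) \<in> set p"
    using covers_columns_strip[OF l(2), of "2 ^ l"] unfolding covers_columns_def l(1) by blast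
  have "s \<in> strip l (2 ^ l)" if s: "length s = r" for s
  proof -
    obtain e w where w: "s = e # w" "length w = l" using s l(1) by (cases s) simp_all
    then obtain i where "i < 2 ^ l" "binary l i = w" using binary_surj by blast
    then show ?thesis using w by (auto simp: strip_def)
  qed
  then have "geodesic_cover (BF r) C"
    using C(3,4) by (auto simp: geodesic_cover_def verts_BF butterfly_verts_def)
  then show ?thesis using C l by (intro exI[of _ C]) simp
qed

lemma gcover_butterfly:
  assumes "r \<ge> 2"
  shows "gcover (BF r) = (2 * 2 ^ r + 2) div 3"
proof -
  obtain C where C: "finite C" "geodesic_cover (BF r) C" "card C \<le> (2 * 2 ^ r + 2) div 3"
    using geodesic_cover_upper[OF assms] by blast
  have lower: "(2 * 2 ^ r + 2) div 3 \<le> card D" if "finite D" "geodesic_cover (BF r) D" for D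
    using card_geodesic_cover_ge[OF that] assms by simp
  have "card C = (2 * 2 ^ r + 2) div 3" using C lower by (simp add: le_antisym)
  then show ?thesis
    unfolding gcover_def using C(1,2) lower by (intro Least_equality) auto
qed

theorem theorem3p7:
  fixes r :: nat
  assumes "r \<ge> 5"
  shows "int (gcover (with_proj (butterfly r))) = \<lceil>(2 / 3 :: real) * 2 ^ r\<rceil>"
proof -
  have "\<lceil>real (2 * m) / 3\<rceil> = int ((2 * m + 2) div 3)" for m
  proof (rule ceiling_unique)
    have "3 * ((2 * m + 2) div 3) < 2 * m + 3" and "2 * m \<le> 3 * ((2 * m + 2) div 3)"
      by presburger+
    then have "real (3 * ((2 * m + 2) div 3)) < real (2 * m + 3)"
      and "real (2 * m) \<le> real (3 * ((2 * m + 2) div 3))"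
      by (simp_all only: of_nat_less_iff of_nat_le_iff)
    then show "of_int (int ((2 * m + 2) div 3)) - 1 < real (2 * m) / 3"
      and "real (2 * m) / 3 \<le> of_int (int ((2 * m + 2) div 3))"
      by (simp_all add: field_simps)
  qed
  from this[of "2 ^ r"] show ?thesis using gcover_butterfly[of r] assms by simp
qed

end
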